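(* Let $\mathcal{V}$ and $\mathcal{W}$ be two varieties, each defined by identities of height at most $1$. \begin{itemize} \item If $\mathcal{V}$ and $\mathcal{W}$ are not congruence modular, then neither is $\mathcal{V}\vee\mathcal{W}$. \item If $\mathcal{V}$ and $\mathcal{W}$ are not congruence $n$-permutable for any $n$, then neither is $\mathcal{V}\vee\mathcal{W}$ (i.e. $\mathcal{V}\vee\mathcal{W}$ is not congruence $n$-permutable for any $n$). \end{itemize}
   Context: An identity of height at most $1$ is an identity of one of the forms $f(x_1,\dots,x_n)\approx g(y_1,\dots,y_m)$, $f(x_1,\dots,x_n)\approx y$, or $x\approx y$, where $f,g$ are operation symbols of the signature and the variables are not necessarily distinct. The join $\mathcal{V}\vee\mathcal{W}$ (in the lattice of interpretability types of varieties) is the variety whose signature is the disjoint union of the signatures of $\mathcal{V}$ and $\mathcal{W}$ and whose set of defining identities is the union of the sets of defining identities of $\mathcal{V}$ and of $\mathcal{W}$. A variety is congruence modular if all its members have modular congruence lattices. For $n\ge2$, it is congruence $n$-permutable if for all congruences $\alpha,\beta$ of any member, $\alpha\circ\beta\circ\alpha\circ\cdots=\beta\circ\alpha\circ\beta\circ\cdots$ with $n$ factors on each side. *)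

theory Defs
  imports "HOL-Algebra.Lattice"
begin

datatype (trm_ops: 'f, trm_vars: 'v) trm = Var 'v | Fun 'f "('f, 'v) trm list"
  for map: map_trm

text \<open>A variety is given by a presentation: a set of operation symbols (possibly empty, possibly
  infinite, nullary symbols allowed), their arities, and a set of defining identities
  \<open>(s, t)\<close>, read \<open>s \<approx> t\<close>.  The value of \<open>arity\<close> outside \<open>symbols\<close> is irrelevant.\<close>

record 'f variety =
  symbols :: "'f set"
  arity :: "'f \<Rightarrow> nat"
  identities :: "(('f, nat) trm \<times> ('f, nat) trm) set"

fun wf_trm :: "'f variety \<Rightarrow> ('f, 'v) trm \<Rightarrow> bool" where
  "wf_trm V (Var x) \<longleftrightarrow> True"
| "wf_trm V (Fun f ts) \<longleftrightarrow>
     f \<in> symbols V \<and> length ts = arity V f \<and> (\<forall>t \<in> set ts. wf_trm V t)"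

definition wf_variety :: "'f variety \<Rightarrow> bool" where
  "wf_variety V \<longleftrightarrow> (\<forall>(s, t) \<in> identities V. wf_trm V s \<and> wf_trm V t)"

definition height_le_1 :: "('f, 'v) trm \<Rightarrow> bool" where
  "height_le_1 t \<longleftrightarrow> (\<exists>x. t = Var x) \<or> (\<exists>f xs. t = Fun f (map Var xs))"

definition defined_by_height_le_1 :: "'f variety \<Rightarrow> bool" where
  "defined_by_height_le_1 V \<longleftrightarrow> (\<forall>(s, t) \<in> identities V. height_le_1 s \<and> height_le_1 t)"

definition variety_join :: "'f variety \<Rightarrow> 'g variety \<Rightarrow> ('f + 'g) variety" where
  "variety_join V W =
     \<lparr> symbols = symbols V <+> symbols W,
       arity = case_sum (arity V) (arity W),
       identities =
         map_prod (map_trm Inl id) (map_trm Inl id) ` identities V \<union>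
         map_prod (map_trm Inr id) (map_trm Inr id) ` identities W \<rparr>"

text \<open>Only the restriction of \<open>oper A f\<close> to lists over the carrier whose length is the
  arity of \<open>f\<close> is meaningful.\<close>

record ('f, 'a) alg = "'a partial_object" +
  oper :: "'f \<Rightarrow> 'a list \<Rightarrow> 'a"

fun eval :: "('f, 'a, 'm) alg_scheme \<Rightarrow> ('v \<Rightarrow> 'a) \<Rightarrow> ('f, 'v) trm \<Rightarrow> 'a" where
  "eval A \<sigma> (Var x) = \<sigma> x"
| "eval A \<sigma> (Fun f ts) = oper A f (map (eval A \<sigma>) ts)"

definition satisfies ::
    "('f, 'a, 'm) alg_scheme \<Rightarrow> ('f, 'v) trm \<times> ('f, 'v) trm \<Rightarrow> bool" where
  "satisfies A e \<longleftrightarrow>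
     (\<forall>\<sigma>. range \<sigma> \<subseteq> carrier A \<longrightarrow> eval A \<sigma> (fst e) = eval A \<sigma> (snd e))"

definition members :: "'f variety \<Rightarrow> ('f, 'a) alg set" where
  "members V = {A. carrier A \<noteq> {} \<and>
     (\<forall>f \<in> symbols V. \<forall>xs. length xs = arity V f \<and> set xs \<subseteq> carrier A \<longrightarrow>
        oper A f xs \<in> carrier A) \<and>
     (\<forall>e \<in> identities V. satisfies A e)}"

definition congruences :: "'f variety \<Rightarrow> ('f, 'a) alg \<Rightarrow> ('a \<times> 'a) set set" where
  "congruences V A = {\<theta>. equiv (carrier A) \<theta> \<and>
     (\<forall>f \<in> symbols V. \<forall>xs ys.
        length xs = arity V f \<and> list_all2 (\<lambda>x y. (x, y) \<in> \<theta>) xs ys \<longrightarrow>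
        (oper A f xs, oper A f ys) \<in> \<theta>)}"

definition congruence_lattice :: "'f variety \<Rightarrow> ('f, 'a) alg \<Rightarrow> ('a \<times> 'a) set gorder" where
  "congruence_lattice V A = \<lparr> carrier = congruences V A, eq = (=), le = (\<subseteq>) \<rparr>"

definition modular :: "('a, 'm) gorder_scheme \<Rightarrow> bool" where
  "modular L \<longleftrightarrow>
     (\<forall>x \<in> carrier L. \<forall>y \<in> carrier L. \<forall>z \<in> carrier L.
        x \<sqsubseteq>\<^bsub>L\<^esub> z \<longrightarrow>
        x \<squnion>\<^bsub>L\<^esub> (y \<sqinter>\<^bsub>L\<^esub> z) = (x \<squnion>\<^bsub>L\<^esub> y) \<sqinter>\<^bsub>L\<^esub> z)"

text \<open>Since HOL cannot quantify over all types inside a formula, the two properties of varieties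
  are relative to the type \<open>'a\<close> of which the carriers of the members are subsets.\<close>

definition congruence_modular :: "'a itself \<Rightarrow> 'f variety \<Rightarrow> bool" where
  "congruence_modular _ V \<longleftrightarrow>
     (\<forall>A :: ('f, 'a) alg. A \<in> members V \<longrightarrow> modular (congruence_lattice V A))"

text \<open>\<open>alternate n \<alpha> \<beta>\<close> is \<open>\<alpha> \<circ> \<beta> \<circ> \<alpha> \<circ> \<dots>\<close> with \<open>n\<close> factors.\<close>

fun alternate :: "nat \<Rightarrow> ('a \<times> 'a) set \<Rightarrow> ('a \<times> 'a) set \<Rightarrow> ('a \<times> 'a) set" where
  "alternate 0 \<alpha> \<beta> = Id"
| "alternate (Suc n) \<alpha> \<beta> = \<alpha> O alternate n \<beta> \<alpha>"

definition congruence_permutable :: "'a itself \<Rightarrow> nat \<Rightarrow> 'f variety \<Rightarrow> bool" where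
  "congruence_permutable _ n V \<longleftrightarrow>
     (\<forall>A :: ('f, 'a) alg. A \<in> members V \<longrightarrow>
        (\<forall>\<alpha> \<in> congruences V A. \<forall>\<beta> \<in> congruences V A. alternate n \<alpha> \<beta> = alternate n \<beta> \<alpha>))"

text \<open>Each property fails in some algebra of \<open>V\<close> over some type iff it fails in an algebra of \<open>V\<close>
  whose carrier is a subset of \<open>('f, nat) trm\<close>: a failure is witnessed by finitely many elements, hence
  occurs in the subalgebra they generate, and this has at most as many elements as there are terms.
  So \<open>TYPE(('f, nat) trm)\<close> gives the absolute notions, for all \<open>n\<close> at once; failure
  over any other type implies failure over this one.\<close>

lemma congruences_Inter:
  assumes "S \<subseteq> congruences V A" "S \<noteq> {}"
  shows "\<Inter>S \<in> congruences V A"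
proof -
  have eq: "\<theta> \<subseteq> carrier A \<times> carrier A" "refl_on (carrier A) \<theta>" "sym \<theta>" "trans \<theta>"
    if "\<theta> \<in> S" for \<theta>
    using assms(1) that by (auto simp: congruences_def equiv_def)
  have "equiv (carrier A) (\<Inter>S)"
  proof (rule equivI)
    show "\<Inter>S \<subseteq> carrier A \<times> carrier A" using eq(1) assms(2) by blast
    show "refl_on (carrier A) (\<Inter>S)" using eq(2) by (auto simp: refl_on_def)
    show "sym (\<Inter>S)" using eq(3) by (auto simp: sym_def)
    show "trans (\<Inter>S)" using eq(4) unfolding trans_def by blast
  qed
  moreover have "(oper A f xs, oper A f ys) \<in> \<theta>"
    if "f \<in> symbols V" "length xs = arity V f" "list_all2 (\<lambda>x y. (x, y) \<in> \<Inter>S) xs ys" "\<theta> \<in> S"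
    for f xs ys \<theta>
  proof -
    have "list_all2 (\<lambda>x y. (x, y) \<in> \<theta>) xs ys"
      using that(3) by (rule list_all2_mono) (use that(4) in auto)
    then show ?thesis using that assms(1) by (auto simp: congruences_def)
  qed
  ultimately show ?thesis by (auto simp: congruences_def)
qed

lemma full_congruence:
  assumes "A \<in> members V"
  shows "carrier A \<times> carrier A \<in> congruences V A"
proof -
  have "set xs \<subseteq> carrier A \<and> set ys \<subseteq> carrier A"
    if "list_all2 (\<lambda>x y. x \<in> carrier A \<and> y \<in> carrier A) xs ys" for xs ys
    using that by (induction rule: list_all2_induct) auto
  note * = this
  have "equiv (carrier A) (carrier A \<times> carrier A)"
    by (auto simp: equiv_def refl_on_def sym_def trans_def)
  moreover have "(oper A f xs, oper A f ys) \<in> carrier A \<times> carrier A"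
    if "f \<in> symbols V" "length xs = arity V f"
      "list_all2 (\<lambda>x y. (x, y) \<in> carrier A \<times> carrier A) xs ys" for f xs ys
  proof -
    have "length ys = arity V f" using that by (auto dest: list_all2_lengthD)
    then show ?thesis using assms that *[of xs ys] by (simp add: members_def)
  qed
  ultimately show ?thesis unfolding congruences_def by blast
qed

lemma lattice_congruence_lattice:
  assumes "A \<in> members V"
  shows "lattice (congruence_lattice V A)"
proof -
  let ?L = "congruence_lattice V A"
  interpret partial_order ?L
    by unfold_locales (auto simp: congruence_lattice_def)
  show ?thesis
  proof unfold_locales
    fix \<alpha> \<beta> assume "\<alpha> \<in> carrier ?L" "\<beta> \<in> carrier ?L"
    then have ab: "\<alpha> \<in> congruences V A" "\<beta> \<in> congruences V A"
      by (auto simp: congruence_lattice_def)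
    let ?U = "{\<theta> \<in> congruences V A. \<alpha> \<subseteq> \<theta> \<and> \<beta> \<subseteq> \<theta>}"
    have "carrier A \<times> carrier A \<in> ?U"
      using full_congruence[OF assms] ab by (auto simp: congruences_def equiv_def)
    then have "\<Inter>?U \<in> congruences V A"
      by (intro congruences_Inter) auto
    then have "least ?L (\<Inter>?U) (Upper ?L {\<alpha>, \<beta>})"
      using ab by (auto simp: least_def Upper_def congruence_lattice_def)
    then show "\<exists>s. least ?L s (Upper ?L {\<alpha>, \<beta>})" by blast
    have "\<alpha> \<inter> \<beta> \<in> congruences V A"
      using congruences_Inter[of "{\<alpha>, \<beta>}" V A] ab by simp
    then have "greatest ?L (\<alpha> \<inter> \<beta>) (Lower ?L {\<alpha>, \<beta>})"
      using ab by (auto simp: greatest_def Lower_def congruence_lattice_def)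
    then show "\<exists>s. greatest ?L s (Lower ?L {\<alpha>, \<beta>})" by blast
  qed
qed

end

theory Submission
  imports Defs "HOL-Library.Countable"
begin

text \<open>
  In each part the property fails in some algebra of \<open>\<V>\<close> and in some algebra of \<open>\<W>\<close>, but
  these algebras have nothing to do with each other.  The idea is to replace them by algebras on one
  common, small set \<open>P\<close> whose operations preserve one common relational structure on \<open>P\<close>.
  The operations of both then live together on \<open>P\<close>, and they form an algebra of the join that
  preserves this structure.  The structure alone suffices to refute the property.

  The passage to \<open>P\<close> is by reflection.  A map \<open>c\<close> from the terms with variables in \<open>P\<close> to \<open>P\<close>
  defines operations \<open>f(p\<^sub>1, \<dots>, p\<^sub>n) = c (f(p\<^sub>1, \<dots>, p\<^sub>n))\<close> on \<open>P\<close>.  Suppose that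
  \<open>c\<close> fixes the variables and identifies terms that are equal in the free algebra.  Then a term of
  height at most one is evaluated by a single application of \<open>c\<close>, so every identity of height at most
  one that holds in the free algebra holds for the new operations (\<open>reflection_member\<close>).  Terms of
  greater height would need nested applications of \<open>c\<close>; this is where the hypothesis on the
  identities enters.

  Modularity: \<open>P\<close> is the square \<open>{False, True}\<^sup>2\<close>.  Its equivalences \<open>\<alpha>\<close> (equal first
  coordinate), \<open>\<beta>\<close> (equal second coordinate) and \<open>\<gamma> \<subseteq> \<alpha>\<close> (which joins only the two points
  with first coordinate \<open>True\<close>) violate the modular law.  In the free algebra generated by \<open>P\<close>, the
  identifications of variables by \<open>\<alpha>\<close>, \<open>\<beta>\<close> and \<open>\<gamma>\<close> induce congruences.  A path from
  \<open>(False, False)\<close> to \<open>(False, True)\<close> in \<open>\<gamma> \<union> (\<alpha> \<inter> \<beta>)\<close> is a sequence of Day terms and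
  makes all members modular (\<open>day_path_modular\<close>).  Without such a path, the terms reachable from
  \<open>(False, False)\<close> determine a colouring \<open>c\<close> that preserves the three relations
  (\<open>not_modular_acts_on_square\<close>).

  Permutability: \<open>P\<close> is the chain \<open>False < True\<close>.  In the free algebra generated by \<open>P\<close>, take the
  compatible preorder generated by \<open>False \<le> True\<close>.  If it also contains \<open>True \<le> False\<close>, the
  witnessing terms are Hagemann--Mitschke terms and the variety is \<open>n\<close>-permutable for some \<open>n\<close>
  (\<open>hm_path_permutable\<close>).  Otherwise the up-set of \<open>True\<close> is a colouring that yields monotone
  operations on the two-element chain (\<open>not_permutable_acts_monotonically\<close>).  A two-element algebra
  has only trivial congruences, but the chain of length \<open>n + 1\<close> is a subalgebra of the \<open>n\<close>-th power
  of such an algebra, and there two congruences fail to \<open>n\<close>-permute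
  (\<open>acts_monotonically_not_permutable\<close>).
\<close>

section \<open>Terms and compatible relations\<close>

lemma eval_map_trm:
  assumes "\<And>f. oper B (h f) = oper A f"
  shows "eval B \<sigma> (map_trm h w t) = eval A (\<sigma> \<circ> w) t"
  by (induction t) (auto simp: assms intro!: arg_cong[where f = "oper A _"])

lemma wf_trm_map_vars [simp]: "wf_trm V (map_trm id w t) = wf_trm V t"
  by (induction t) auto

text \<open>Compatibility is kept apart from being an equivalence: the proof of the modular case uses
  tolerances, and the proof of the permutable case uses an order.\<close>

definition compatible :: "'f variety \<Rightarrow> ('f, 'a) alg \<Rightarrow> ('a \<times> 'a) set \<Rightarrow> bool" where
  "compatible V A R \<longleftrightarrow> (\<forall>f \<in> symbols V. \<forall>xs ys.
     length xs = arity V f \<and> list_all2 (\<lambda>x y. (x, y) \<in> R) xs ys \<longrightarrow>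
     (oper A f xs, oper A f ys) \<in> R)"

lemma congruence_iff:
  "\<theta> \<in> congruences V A \<longleftrightarrow> equiv (carrier A) \<theta> \<and> compatible V A \<theta>"
  by (simp add: congruences_def compatible_def)

lemma compatibleD:
  assumes "compatible V A R" "f \<in> symbols V" "length xs = arity V f"
    "list_all2 (\<lambda>x y. (x, y) \<in> R) xs ys"
  shows "(oper A f xs, oper A f ys) \<in> R"
  using assms unfolding compatible_def by blast

lemma eval_compatible:
  assumes "compatible V A R" "wf_trm V t" "\<And>v. (\<sigma> v, \<tau> v) \<in> R"
  shows "(eval A \<sigma> t, eval A \<tau> t) \<in> R"
  using assms(2)
proof (induction t)
  case (Fun f ts)
  then have "list_all2 (\<lambda>x y. (x, y) \<in> R) (map (eval A \<sigma>) ts) (map (eval A \<tau>) ts)"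
    by (auto simp: list_all2_map1 list_all2_map2 list.rel_refl_strong)
  then show ?case using assms(1) Fun.prems by (simp add: compatible_def)
qed (use assms(3) in auto)

lemma compatible_relcomp:
  assumes "compatible V A R" "compatible V A S"
  shows "compatible V A (R O S)"
  unfolding compatible_def
proof (intro ballI allI impI; elim conjE)
  fix f xs zs
  assume f: "f \<in> symbols V" "length xs = arity V f"
    and "list_all2 (\<lambda>x y. (x, y) \<in> R O S) xs zs"
  then have "list_all2 ((\<lambda>x y. (x, y) \<in> R) OO (\<lambda>x y. (x, y) \<in> S)) xs zs"
    by (auto elim!: list_all2_mono)
  then obtain ys where "list_all2 (\<lambda>x y. (x, y) \<in> R) xs ys"
      "list_all2 (\<lambda>x y. (x, y) \<in> S) ys zs"
    by (auto simp: list.rel_compp)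
  moreover from this have "length ys = arity V f"
    using f by (auto dest: list_all2_lengthD)
  ultimately show "(oper A f xs, oper A f zs) \<in> R O S"
    using assms f unfolding compatible_def by blast
qed

text \<open>Operations are finitary, so finitely many related pairs already lie in one member of an increasing
  sequence of relations.\<close>

lemma compatible_chain_Union:
  fixes Q :: "nat \<Rightarrow> ('a \<times> 'a) set"
  assumes "\<And>k. compatible V A (Q k)" "mono Q"
  shows "compatible V A (\<Union>k. Q k)"
  unfolding compatible_def
proof (intro ballI allI impI; elim conjE)
  fix f xs ys
  assume f: "f \<in> symbols V" "length xs = arity V f"
    and "list_all2 (\<lambda>x y. (x, y) \<in> (\<Union>k. Q k)) xs ys"
  from this(3) have "\<exists>k. list_all2 (\<lambda>x y. (x, y) \<in> Q k) xs ys"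
  proof (induction rule: list_all2_induct)
    case (Cons x xs y ys)
    then obtain k l where "(x, y) \<in> Q k" "list_all2 (\<lambda>x y. (x, y) \<in> Q l) xs ys" by auto
    moreover have "Q k \<subseteq> Q (max k l)" "Q l \<subseteq> Q (max k l)"
      using assms(2) by (auto simp: mono_def)
    ultimately have "list_all2 (\<lambda>x y. (x, y) \<in> Q (max k l)) (x # xs) (y # ys)"
      by (auto elim: list_all2_mono)
    then show ?case by blast
  qed simp
  then show "(oper A f xs, oper A f ys) \<in> (\<Union>k. Q k)"
    using assms(1) f unfolding compatible_def by blast
qed

section \<open>Joins of congruences\<close>

text \<open>The tolerances \<open>zigzag \<beta> \<gamma> k\<close> increase from \<open>\<beta>\<close> to the join of \<open>\<beta>\<close> and \<open>\<gamma>\<close>.  They are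
  not transitive, but each arises from the previous one by a single use of \<open>\<gamma>\<close>, which is the
  shape in which Day terms can be applied.\<close>

fun zigzag :: "('a \<times> 'a) set \<Rightarrow> ('a \<times> 'a) set \<Rightarrow> nat \<Rightarrow> ('a \<times> 'a) set" where
  "zigzag \<beta> \<gamma> 0 = \<beta>"
| "zigzag \<beta> \<gamma> (Suc k) = zigzag \<beta> \<gamma> k O \<gamma> O zigzag \<beta> \<gamma> k"

lemma congruenceD:
  assumes "\<theta> \<in> congruences V A"
  shows "\<theta> \<subseteq> carrier A \<times> carrier A" "refl_on (carrier A) \<theta>" "sym \<theta>" "trans \<theta>" "compatible V A \<theta>"
  using assms by (auto simp: congruence_iff equiv_def)

context
  fixes V :: "'f variety" and A :: "('f, 'a) alg" and \<beta> \<gamma> :: "('a \<times> 'a) set"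
  assumes beta: "\<beta> \<in> congruences V A" and gamma: "\<gamma> \<in> congruences V A"
begin

lemma zigzag_refl_sym_compatible:
  "zigzag \<beta> \<gamma> k \<subseteq> carrier A \<times> carrier A \<and> refl_on (carrier A) (zigzag \<beta> \<gamma> k) \<and>
   sym (zigzag \<beta> \<gamma> k) \<and> compatible V A (zigzag \<beta> \<gamma> k)"
proof (induction k)
  case 0
  then show ?case using congruenceD[OF beta] by auto
next
  case (Suc k)
  let ?Z = "zigzag \<beta> \<gamma> k"
  have "sym (?Z O \<gamma> O ?Z)"
  proof (rule symI)
    fix a d assume "(a, d) \<in> ?Z O \<gamma> O ?Z"
    then obtain b c where "(a, b) \<in> ?Z" "(b, c) \<in> \<gamma>" "(c, d) \<in> ?Z" by blast
    then have "(b, a) \<in> ?Z" "(c, b) \<in> \<gamma>" "(d, c) \<in> ?Z"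
      using Suc congruenceD(3)[OF gamma] by (auto dest: symD)
    then show "(d, a) \<in> ?Z O \<gamma> O ?Z" by blast
  qed
  moreover have "refl_on (carrier A) (?Z O \<gamma> O ?Z)"
  proof (rule refl_onI)
    fix a assume "a \<in> carrier A"
    then have "(a, a) \<in> ?Z" "(a, a) \<in> \<gamma>"
      using Suc congruenceD(2)[OF gamma] by (auto dest: refl_onD)
    then show "(a, a) \<in> ?Z O \<gamma> O ?Z" by blast
  qed
  moreover have "compatible V A (?Z O \<gamma> O ?Z)"
    using Suc congruenceD(5)[OF gamma] by (auto intro!: compatible_relcomp)
  ultimately show ?case using Suc by auto
qed

lemma zigzag_Suc: "zigzag \<beta> \<gamma> k \<subseteq> zigzag \<beta> \<gamma> (Suc k)"
proof
  fix p assume p: "p \<in> zigzag \<beta> \<gamma> k"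
  then have "snd p \<in> carrier A" using zigzag_refl_sym_compatible[of k] by auto
  then have "(snd p, snd p) \<in> \<gamma>" "(snd p, snd p) \<in> zigzag \<beta> \<gamma> k"
    using zigzag_refl_sym_compatible[of k] congruenceD(2)[OF gamma] by (auto simp: refl_on_def)
  then show "p \<in> zigzag \<beta> \<gamma> (Suc k)" using p by (cases p) auto
qed

lemma mono_zigzag: "mono (zigzag \<beta> \<gamma>)"
  by (simp only: mono_iff_le_Suc zigzag_Suc simp_thms)

lemma Union_zigzag: "(\<Union>k. zigzag \<beta> \<gamma> k) = (\<beta> \<union> \<gamma>)\<^sup>+"
proof
  have "zigzag \<beta> \<gamma> k \<subseteq> (\<beta> \<union> \<gamma>)\<^sup>+" for k
  proof (induction k)
    case (Suc k)
    show ?case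
    proof clarsimp
      fix a b c d assume "(a, b) \<in> zigzag \<beta> \<gamma> k" "(b, c) \<in> \<gamma>" "(c, d) \<in> zigzag \<beta> \<gamma> k"
      then have "(a, b) \<in> (\<beta> \<union> \<gamma>)\<^sup>+" "(b, c) \<in> (\<beta> \<union> \<gamma>)\<^sup>+" "(c, d) \<in> (\<beta> \<union> \<gamma>)\<^sup>+"
        using Suc by auto
      then show "(a, d) \<in> (\<beta> \<union> \<gamma>)\<^sup>+" by (meson trancl_trans)
    qed
  qed auto
  then show "(\<Union>k. zigzag \<beta> \<gamma> k) \<subseteq> (\<beta> \<union> \<gamma>)\<^sup>+" by blast
next
  have refl: "(a, a) \<in> \<gamma> \<and> (\<forall>k. (a, a) \<in> zigzag \<beta> \<gamma> k)" if "a \<in> carrier A" for a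
    using that zigzag_refl_sym_compatible congruenceD(2)[OF gamma] by (auto simp: refl_on_def)
  have beta_le: "\<beta> \<subseteq> zigzag \<beta> \<gamma> k" for k
    using mono_zigzag[THEN monoD, of 0 k] by simp
  have extend: "(a, c) \<in> zigzag \<beta> \<gamma> (Suc k)" 
    if "(a, b) \<in> zigzag \<beta> \<gamma> k" "(b, c) \<in> \<beta> \<union> \<gamma>" for a b c k
  proof -
    have "b \<in> carrier A" "c \<in> carrier A"
      using that(2) congruenceD(1)[OF gamma] congruenceD(1)[OF beta] by auto
    then show ?thesis
      using that refl beta_le[of k] by (simp only: zigzag.simps) blast
  qed
  show "(\<beta> \<union> \<gamma>)\<^sup>+ \<subseteq> (\<Union>k. zigzag \<beta> \<gamma> k)"
  proof (rule subrelI)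
    fix a b assume "(a, b) \<in> (\<beta> \<union> \<gamma>)\<^sup>+"
    then show "(a, b) \<in> (\<Union>k. zigzag \<beta> \<gamma> k)"
    proof induction
      case (base b)
      then have "a \<in> carrier A"
        using congruenceD(1)[OF gamma] congruenceD(1)[OF beta] by auto
      then show ?case using extend[of a a 0 b] base refl by blast
    next
      case (step b c)
      then obtain k where "(a, b) \<in> zigzag \<beta> \<gamma> k" by auto
      then show ?case using extend step.hyps by blast
    qed
  qed
qed

text \<open>Paths for the different arguments of an operation may differ in length; the increasing zigzags
  bring them to a common length, which makes the transitive closure compatible.\<close>

lemma congruence_trancl: "(\<beta> \<union> \<gamma>)\<^sup>+ \<in> congruences V A"
proof -
  let ?J = "(\<beta> \<union> \<gamma>)\<^sup>+"
  have "refl_on (carrier A) ?J"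
    using congruenceD(2)[OF beta] by (auto simp: refl_on_def)
  moreover have "?J \<subseteq> carrier A \<times> carrier A"
    using congruenceD(1)[OF beta] congruenceD(1)[OF gamma] by (intro trancl_subset_Sigma) auto
  moreover have "sym ?J"
    using congruenceD(3)[OF beta] congruenceD(3)[OF gamma] by (simp add: sym_Un sym_trancl)
  moreover have "compatible V A ?J"
    unfolding Union_zigzag[symmetric]
    using zigzag_refl_sym_compatible mono_zigzag by (intro compatible_chain_Union) auto
  ultimately show ?thesis by (auto simp: congruence_iff equiv_def)
qed

lemma join_congruences:
  assumes "A \<in> members V"
  shows "\<beta> \<squnion>\<^bsub>congruence_lattice V A\<^esub> \<gamma> = (\<beta> \<union> \<gamma>)\<^sup>+"
proof -
  let ?L = "congruence_lattice V A"
  interpret lattice ?L by (rule lattice_congruence_lattice[OF assms])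
  have mem: "\<beta> \<in> carrier ?L" "\<gamma> \<in> carrier ?L" "(\<beta> \<union> \<gamma>)\<^sup>+ \<in> carrier ?L"
    using beta gamma congruence_trancl by (auto simp: congruence_lattice_def)
  have "(\<beta> \<union> \<gamma>)\<^sup>+ \<subseteq> \<theta>" if "\<theta> \<in> congruences V A" "\<beta> \<subseteq> \<theta>" "\<gamma> \<subseteq> \<theta>" for \<theta>
    using that congruenceD(4)[OF that(1)] by (metis Un_least trancl_id trancl_mono_subset)
  moreover have "\<beta> \<subseteq> \<beta> \<squnion>\<^bsub>?L\<^esub> \<gamma>" "\<gamma> \<subseteq> \<beta> \<squnion>\<^bsub>?L\<^esub> \<gamma>" "\<beta> \<squnion>\<^bsub>?L\<^esub> \<gamma> \<in> congruences V A"
    using join_left[OF mem(1,2)] join_right[OF mem(1,2)] join_closed[OF mem(1,2)]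
    by (auto simp: congruence_lattice_def)
  moreover have "\<beta> \<squnion>\<^bsub>?L\<^esub> \<gamma> \<sqsubseteq>\<^bsub>?L\<^esub> (\<beta> \<union> \<gamma>)\<^sup>+"
    using mem by (intro join_le) (auto simp: congruence_lattice_def)
  ultimately show ?thesis by (auto simp: congruence_lattice_def)
qed

lemma meet_congruences:
  assumes "A \<in> members V"
  shows "\<beta> \<sqinter>\<^bsub>congruence_lattice V A\<^esub> \<gamma> = \<beta> \<inter> \<gamma> \<and> \<beta> \<inter> \<gamma> \<in> congruences V A"
proof -
  let ?L = "congruence_lattice V A"
  interpret lattice ?L by (rule lattice_congruence_lattice[OF assms])
  have int: "\<beta> \<inter> \<gamma> \<in> congruences V A"
    using congruences_Inter[of "{\<beta>, \<gamma>}" V A] beta gamma by simp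
  have mem: "\<beta> \<in> carrier ?L" "\<gamma> \<in> carrier ?L" "\<beta> \<inter> \<gamma> \<in> carrier ?L"
    using beta gamma int by (auto simp: congruence_lattice_def)
  have "\<beta> \<inter> \<gamma> \<sqsubseteq>\<^bsub>?L\<^esub> \<beta> \<sqinter>\<^bsub>?L\<^esub> \<gamma>" 
    using mem by (intro meet_le) (auto simp: congruence_lattice_def)
  moreover have "\<beta> \<sqinter>\<^bsub>?L\<^esub> \<gamma> \<sqsubseteq>\<^bsub>?L\<^esub> \<beta>" "\<beta> \<sqinter>\<^bsub>?L\<^esub> \<gamma> \<sqsubseteq>\<^bsub>?L\<^esub> \<gamma>"
    using mem by (auto intro: meet_left meet_right)
  ultimately show ?thesis using int by (auto simp: congruence_lattice_def)
qed

end

lemma modular_congruence_lattice_iff: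
  assumes "A \<in> members V"
  shows "modular (congruence_lattice V A) \<longleftrightarrow>
    (\<forall>\<alpha> \<in> congruences V A. \<forall>\<beta> \<in> congruences V A. \<forall>\<gamma> \<in> congruences V A. \<gamma> \<subseteq> \<alpha> \<longrightarrow>
       \<alpha> \<inter> (\<gamma> \<union> \<beta>)\<^sup>+ \<subseteq> (\<gamma> \<union> (\<beta> \<inter> \<alpha>))\<^sup>+)"
proof -
  let ?L = "congruence_lattice V A"
  have "\<gamma> \<squnion>\<^bsub>?L\<^esub> (\<beta> \<sqinter>\<^bsub>?L\<^esub> \<alpha>) = (\<gamma> \<squnion>\<^bsub>?L\<^esub> \<beta>) \<sqinter>\<^bsub>?L\<^esub> \<alpha> \<longleftrightarrow>
      \<alpha> \<inter> (\<gamma> \<union> \<beta>)\<^sup>+ \<subseteq> (\<gamma> \<union> (\<beta> \<inter> \<alpha>))\<^sup>+"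
    if c: "\<alpha> \<in> congruences V A" "\<beta> \<in> congruences V A" "\<gamma> \<in> congruences V A" and "\<gamma> \<subseteq> \<alpha>" for \<alpha> \<beta> \<gamma>
  proof -
    have "(\<gamma> \<union> (\<beta> \<inter> \<alpha>))\<^sup>+ \<subseteq> \<alpha>"
      using \<open>\<gamma> \<subseteq> \<alpha>\<close> congruenceD(4)[OF c(1)] by (metis Un_least inf_le2 trancl_id trancl_mono_subset)
    moreover have "(\<gamma> \<union> (\<beta> \<inter> \<alpha>))\<^sup>+ \<subseteq> (\<gamma> \<union> \<beta>)\<^sup>+"
      by (intro trancl_mono_subset) auto
    ultimately show ?thesis
      using meet_congruences[OF c(2,1) assms] join_congruences[OF c(3,2) assms]
        meet_congruences[OF congruence_trancl[OF c(3,2)] c(1) assms]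
        join_congruences[OF c(3) conjunct2[OF meet_congruences[OF c(2,1) assms]] assms]
      by auto
  qed
  moreover have "carrier ?L = congruences V A" "\<And>x y. x \<sqsubseteq>\<^bsub>?L\<^esub> y \<longleftrightarrow> x \<subseteq> y"
    by (auto simp: congruence_lattice_def)
  ultimately show ?thesis
    unfolding modular_def by simp blast
qed

section \<open>Reflections of term algebras\<close>

text \<open>The kernel of the map from the free algebra on \<open>'v\<close> to the free algebra on \<open>'w\<close> induced by
  \<open>w\<close>, both free in the variety generated by \<open>K\<close>: two terms are related if they become equal in
  \<open>K\<close> once their variables are renamed by \<open>w\<close>.  For \<open>w = id\<close> it is equality in the free
  algebra.  Working with terms and these kernels avoids forming the quotient.\<close>

definition term_kernel ::
    "'f variety \<Rightarrow> ('f, 'a) alg set \<Rightarrow> ('v \<Rightarrow> 'w) \<Rightarrow> (('f, 'v) trm \<times> ('f, 'v) trm) set" where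
  "term_kernel V K w = {(s, t). wf_trm V s \<and> wf_trm V t \<and>
     (\<forall>A \<in> K. \<forall>\<sigma>. range \<sigma> \<subseteq> carrier A \<longrightarrow> eval A (\<sigma> \<circ> w) s = eval A (\<sigma> \<circ> w) t)}"

lemma term_kernel_sym: "(s, t) \<in> term_kernel V K w \<Longrightarrow> (t, s) \<in> term_kernel V K w"
  by (auto simp: term_kernel_def)

lemma term_kernel_trans:
  "(s, t) \<in> term_kernel V K w \<Longrightarrow> (t, u) \<in> term_kernel V K w \<Longrightarrow> (s, u) \<in> term_kernel V K w"
  by (auto simp: term_kernel_def)

lemma term_kernel_wf: "(s, t) \<in> term_kernel V K w \<Longrightarrow> wf_trm V s \<and> wf_trm V t"
  by (auto simp: term_kernel_def)

lemma term_kernel_refl: "wf_trm V t \<Longrightarrow> (t, t) \<in> term_kernel V K w"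
  by (auto simp: term_kernel_def)

lemma term_kernel_Var: "w x = w y \<Longrightarrow> (Var x, Var y) \<in> term_kernel V K w"
  by (auto simp: term_kernel_def)

lemma term_kernelD:
  assumes "(s, t) \<in> term_kernel V K w" "A \<in> K" "range \<sigma> \<subseteq> carrier A"
  shows "eval A (\<sigma> \<circ> w) s = eval A (\<sigma> \<circ> w) t"
  using assms by (auto simp: term_kernel_def)

lemma term_kernel_comp: "term_kernel V K w \<subseteq> term_kernel V K (w' \<circ> w)"
proof clarify
  fix s t assume st: "(s, t) \<in> term_kernel V K w"
  have "eval A (\<sigma> \<circ> (w' \<circ> w)) s = eval A (\<sigma> \<circ> (w' \<circ> w)) t"
    if "A \<in> K" "range \<sigma> \<subseteq> carrier A" for A \<sigma>
    using term_kernelD[OF st that(1), of "\<sigma> \<circ> w'"] that(2) by (auto simp: o_assoc)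
  then show "(s, t) \<in> term_kernel V K (w' \<circ> w)"
    using st by (auto simp: term_kernel_def)
qed

lemma term_kernel_id: "term_kernel V K id \<subseteq> term_kernel V K w"
  using term_kernel_comp[of V K id w] by simp

definition reflection :: "(('f, 'p) trm \<Rightarrow> 'p) \<Rightarrow> ('f, 'p) alg" where
  "reflection c = \<lparr>carrier = UNIV, oper = (\<lambda>f ps. c (Fun f (map Var ps)))\<rparr>"

lemma carrier_reflection [simp]: "carrier (reflection c) = UNIV"
  by (simp add: reflection_def)

text \<open>Height at most one means that \<open>c\<close> is applied only once: to the whole term if there is an
  operation symbol, and to a variable, which it fixes, otherwise.\<close>

lemma eval_reflection:
  assumes "height_le_1 t" "\<And>p. c (Var p) = p"
  shows "eval (reflection c) \<sigma> t = c (map_trm id \<sigma> t)"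
  using assms by (auto simp: height_le_1_def reflection_def comp_def)

lemma reflection_member:
  assumes "wf_variety V" "defined_by_height_le_1 V" "K \<subseteq> members V"
    and Var: "\<And>p. c (Var p) = p"
    and inv: "\<And>s t. (s, t) \<in> term_kernel V K id \<Longrightarrow> c s = c t"
  shows "reflection c \<in> members V"
proof -
  have "eval (reflection c) \<sigma> s = eval (reflection c) \<sigma> t" if "(s, t) \<in> identities V" for s t \<sigma>
  proof -
    have st: "height_le_1 s" "height_le_1 t" "wf_trm V s" "wf_trm V t"
      using assms(1,2) that by (auto simp: wf_variety_def defined_by_height_le_1_def)
    have "eval A \<tau> (map_trm id \<sigma> s) = eval A \<tau> (map_trm id \<sigma> t)"
      if "A \<in> K" "range \<tau> \<subseteq> carrier A" for A \<tau>
    proof -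
      have "satisfies A (s, t)" using \<open>(s, t) \<in> identities V\<close> \<open>A \<in> K\<close> assms(3) by (auto simp: members_def)
      moreover have "range (\<tau> \<circ> \<sigma>) \<subseteq> carrier A" using that by auto
      ultimately have "eval A (\<tau> \<circ> \<sigma>) s = eval A (\<tau> \<circ> \<sigma>) t" by (auto simp: satisfies_def)
      then show ?thesis by (simp add: eval_map_trm[where A = A and h = id])
    qed
    then have "(map_trm id \<sigma> s, map_trm id \<sigma> t) \<in> term_kernel V K id"
      using st by (auto simp: term_kernel_def)
    then show ?thesis using inv st Var by (simp add: eval_reflection)
  qed
  then show ?thesis by (auto simp: members_def satisfies_def)
qed

text \<open>Tuples that agree under \<open>w\<close> turn into terms that agree after renaming by \<open>w\<close>; hence it is
  enough that the colouring respects the kernel of \<open>w\<close>.\<close>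

lemma reflection_compatible:
  fixes K :: "('f, 'a) alg set"
  assumes "\<And>s t. (s, t) \<in> term_kernel V K w \<Longrightarrow> w (c s) = w (c t)"
  shows "compatible V (reflection c) {(p, q). w p = w q}"
  unfolding compatible_def
proof (intro ballI allI impI; elim conjE)
  fix f ps qs
  assume f: "f \<in> symbols V" "length ps = arity V f"
    and "list_all2 (\<lambda>p q. (p, q) \<in> {(p, q). w p = w q}) ps qs"
  then have qs: "length qs = arity V f" "map w ps = map w qs"
    by (auto simp: list_all2_conv_all_nth list_eq_iff_nth_eq)
  have "map (eval A (\<sigma> \<circ> w)) (map Var ps) = map (eval A (\<sigma> \<circ> w)) (map Var qs)" for A :: "('f, 'a) alg" and \<sigma>
    using arg_cong[OF qs(2), of "map \<sigma>"] by (simp add: comp_def)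
  then have "(Fun f (map Var ps), Fun f (map Var qs)) \<in> term_kernel V K w"
    using f qs(1) by (auto simp: term_kernel_def simp del: map_map)
  then show "(oper (reflection c) f ps, oper (reflection c) f qs) \<in> {(p, q). w p = w q}"
    using assms by (simp add: reflection_def)
qed

section \<open>Failure of modularity gives operations on the square\<close>

text \<open>The corners of the square are the four variables of Day terms: with \<open>x = (False, False)\<close>,
  \<open>y = (True, False)\<close>, \<open>z = (True, True)\<close> and \<open>u = (False, True)\<close>, the congruence \<open>\<alpha>\<close> has the
  classes \<open>{x, u}\<close> and \<open>{y, z}\<close>, the congruence \<open>\<beta>\<close> has the classes \<open>{x, y}\<close> and \<open>{z, u}\<close>,
  and \<open>\<gamma>\<close> identifies only \<open>y\<close> and \<open>z\<close>.  Each is given by a choice of representatives.\<close>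

definition alpha_rep :: "bool \<times> bool \<Rightarrow> bool \<times> bool" where "alpha_rep p = (fst p, False)"
definition beta_rep :: "bool \<times> bool \<Rightarrow> bool \<times> bool" where "beta_rep p = (False, snd p)"
definition gamma_rep :: "bool \<times> bool \<Rightarrow> bool \<times> bool" where
  "gamma_rep p = (fst p, \<not> fst p \<and> snd p)"

lemmas rep_defs = alpha_rep_def beta_rep_def gamma_rep_def

text \<open>One step on the way from \<open>x\<close> to \<open>u\<close> in \<open>\<gamma> \<or> (\<alpha> \<and> \<beta>)\<close> in the free algebra on the square.
  The successive terms \<open>m\<^sub>i\<close> of such a path satisfy \<open>m\<^sub>i(x,y,y,x) = x\<close>, and neighbours satisfy
  \<open>m\<^sub>i(x,y,y,u) = m\<^sub>i\<^sub>+\<^sub>1(x,y,y,u)\<close> or \<open>m\<^sub>i(x,x,u,u) = m\<^sub>i\<^sub>+\<^sub>1(x,x,u,u)\<close>, as Day terms do.\<close>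

definition day_step ::
    "'f variety \<Rightarrow> ('f, 'a) alg set \<Rightarrow> (('f, bool \<times> bool) trm \<times> ('f, bool \<times> bool) trm) set" where
  "day_step V K = term_kernel V K gamma_rep \<union> (term_kernel V K alpha_rep \<inter> term_kernel V K beta_rep)"

lemma gamma_kernel_alpha: "term_kernel V K gamma_rep \<subseteq> term_kernel V K alpha_rep"
proof -
  have "alpha_rep = alpha_rep \<circ> gamma_rep" by (auto simp: rep_defs)
  then show ?thesis using term_kernel_comp[of V K gamma_rep alpha_rep] by simp
qed

lemma day_path_alpha:
  assumes "(Var (False, False), t) \<in> (day_step V K)\<^sup>*"
  shows "(Var (False, False), t) \<in> term_kernel V K alpha_rep"
  using assms
proof induction
  case base
  show ?case by (rule term_kernel_Var) simp
next
  case (step s t)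
  then show ?case
    using gamma_kernel_alpha[of V K] by (auto simp: day_step_def intro: term_kernel_trans)
qed

text \<open>Day's argument, for a tolerance \<open>R\<close> instead of a congruence \<open>\<beta>\<close>.  Given
  \<open>a R b \<gamma> c R d\<close> with \<open>a \<alpha> d\<close>, evaluate the terms of the path at \<open>(a, b, c, d)\<close>.  The
  values lead from \<open>a\<close> to \<open>d\<close> within one class of \<open>\<alpha>\<close>.  Replacing \<open>c\<close> by \<open>b\<close> changes them
  within \<open>\<gamma>\<close>, and replacing \<open>b\<close> by \<open>a\<close> and \<open>c\<close> by \<open>d\<close> changes them within \<open>R\<close>; one of
  the two replacements makes neighbouring values equal.\<close>

lemma day_path_shift:
  assumes path: "(Var (False, False), Var (False, True)) \<in> (day_step V K)\<^sup>*"
    and A: "A \<in> K" "K \<subseteq> members V"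
    and \<alpha>: "\<alpha> \<in> congruences V A" and \<gamma>: "\<gamma> \<in> congruences V A" "\<gamma> \<subseteq> \<alpha>"
    and R: "R \<subseteq> carrier A \<times> carrier A" "refl_on (carrier A) R" "sym R" "compatible V A R"
  shows "\<alpha> \<inter> (R O \<gamma> O R) \<subseteq> (\<gamma> \<union> (\<alpha> \<inter> R))\<^sup>*"
proof clarify
  fix a b c d
  assume ad: "(a, d) \<in> \<alpha>" and ab: "(a, b) \<in> R" and bc: "(b, c) \<in> \<gamma>" and cd: "(c, d) \<in> R"
  have [simp]: "a \<in> carrier A" "b \<in> carrier A" "c \<in> carrier A" "d \<in> carrier A"
    using ab cd R(1) by auto
  have refl: "(u, u) \<in> \<alpha>" "(u, u) \<in> \<gamma>" "(u, u) \<in> R" if "u \<in> carrier A" for u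
    using that R(2) congruenceD(2)[OF \<alpha>] congruenceD(2)[OF \<gamma>(1)] by (auto dest: refl_onD)
  note [dest] = symD[OF congruenceD(3)[OF \<alpha>]] symD[OF congruenceD(3)[OF \<gamma>(1)]] symD[OF R(3)]
  define v where "v p = (if p = (False, False) then a else if p = (True, False) then b
                         else if p = (True, True) then c else d)" for p :: "bool \<times> bool"
  have v: "range v \<subseteq> carrier A" by (auto simp: v_def)
  let ?e = "\<lambda>t. eval A v t"
  have alpha_a: "(?e t, a) \<in> \<alpha> \<and> (?e t, eval A (v \<circ> beta_rep) t) \<in> \<alpha>"
    if "(Var (False, False), t) \<in> term_kernel V K alpha_rep" for t
  proof -
    have wf: "wf_trm V t" using term_kernel_wf[OF that] by simp
    have "(v p, (v \<circ> alpha_rep) p) \<in> \<alpha>" for p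
      using ad bc \<gamma>(2) refl by (cases p) (auto simp: v_def rep_defs)
    then have "(?e t, eval A (v \<circ> alpha_rep) t) \<in> \<alpha>"
      using congruenceD(5)[OF \<alpha>] wf by (intro eval_compatible)
    moreover have "eval A (v \<circ> alpha_rep) t = a"
      using term_kernelD[OF that A(1) v] by (simp add: v_def rep_defs)
    moreover have "((v \<circ> beta_rep) p, ((\<lambda>_. a) \<circ> alpha_rep) p) \<in> \<alpha>" for p
      using ad refl by (cases p) (auto simp: v_def rep_defs)
    then have "(eval A (v \<circ> beta_rep) t, eval A ((\<lambda>_. a) \<circ> alpha_rep) t) \<in> \<alpha>"
      using congruenceD(5)[OF \<alpha>] wf by (intro eval_compatible)
    moreover have "eval A ((\<lambda>_. a) \<circ> alpha_rep) t = a"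
      using term_kernelD[OF that A(1), of "\<lambda>_. a"] by simp
    ultimately show ?thesis
      using congruenceD(4)[OF \<alpha>] by (auto dest: transD)
  qed
  have gamma_c: "(?e t, eval A (v \<circ> gamma_rep) t) \<in> \<gamma>" if "wf_trm V t" for t
  proof -
    have "(v p, (v \<circ> gamma_rep) p) \<in> \<gamma>" for p
      using bc refl by (cases p) (auto simp: v_def rep_defs)
    then show ?thesis using congruenceD(5)[OF \<gamma>(1)] that by (intro eval_compatible)
  qed
  have R_c: "(?e t, eval A (v \<circ> beta_rep) t) \<in> R" if "wf_trm V t" for t
  proof -
    have "(v p, (v \<circ> beta_rep) p) \<in> R" for p
      using ab cd refl by (cases p) (auto simp: v_def rep_defs)
    then show ?thesis using R(4) that by (intro eval_compatible)
  qed
  have "(a, ?e t) \<in> (\<gamma> \<union> (\<alpha> \<inter> R))\<^sup>*" if "(Var (False, False), t) \<in> (day_step V K)\<^sup>*" for t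
    using that
  proof induction
    case base
    show ?case by (simp add: v_def)
  next
    case (step s t)
    have s: "(Var (False, False), s) \<in> term_kernel V K alpha_rep"
      using step.hyps day_path_alpha by blast
    have t: "(Var (False, False), t) \<in> term_kernel V K alpha_rep"
      using step.hyps day_path_alpha by (meson rtrancl.rtrancl_into_rtrancl)
    have wf: "wf_trm V s" "wf_trm V t" using term_kernel_wf s t by blast+
    consider "(s, t) \<in> term_kernel V K gamma_rep" | "(s, t) \<in> term_kernel V K beta_rep"
      using step.hyps by (auto simp: day_step_def)
    then have "(?e s, ?e t) \<in> (\<gamma> \<union> (\<alpha> \<inter> R))\<^sup>*"
    proof cases
      case 1
      then have "(?e s, ?e t) \<in> \<gamma>"
        using term_kernelD[OF 1 A(1) v] gamma_c[OF wf(1)] gamma_c[OF wf(2)]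
          congruenceD(4)[OF \<gamma>(1)] by (auto dest: transD)
      then show ?thesis by blast
    next
      case 2
      let ?m = "eval A (v \<circ> beta_rep)"
      have "(?e s, ?m s) \<in> \<alpha> \<inter> R" "(?m t, ?e t) \<in> \<alpha> \<inter> R" 
        using alpha_a[OF s] alpha_a[OF t] R_c[OF wf(1)] R_c[OF wf(2)] by auto
      moreover have "?m s = ?m t" using term_kernelD[OF 2 A(1) v] .
      ultimately show ?thesis
        by (metis UnI2 converse_rtrancl_into_rtrancl r_into_rtrancl)
    qed
    then show ?case using step.IH by simp
  qed
  from this[OF path] show "(a, d) \<in> (\<gamma> \<union> (\<alpha> \<inter> R))\<^sup>*" by (simp add: v_def)
qed

text \<open>Removing one \<open>\<gamma>\<close> at a time from the zigzags that exhaust \<open>\<beta> \<or> \<gamma>\<close>.\<close>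

lemma day_path_modular:
  fixes V :: "'f variety" and A :: "('f, 'a) alg"
  assumes path: "(Var (False, False), Var (False, True)) \<in> (day_step V (members V :: ('f, 'a) alg set))\<^sup>*"
    and A: "A \<in> members V"
  shows "modular (congruence_lattice V A)"
  unfolding modular_congruence_lattice_iff[OF A]
proof (intro ballI impI)
  fix \<alpha> \<beta> \<gamma>
  assume c: "\<alpha> \<in> congruences V A" "\<beta> \<in> congruences V A" "\<gamma> \<in> congruences V A" and le: "\<gamma> \<subseteq> \<alpha>"
  have *: "\<alpha> \<inter> zigzag \<beta> \<gamma> k \<subseteq> (\<gamma> \<union> (\<beta> \<inter> \<alpha>))\<^sup>*" for k
  proof (induction k)
    case (Suc k)
    have "\<alpha> \<inter> zigzag \<beta> \<gamma> (Suc k) \<subseteq> (\<gamma> \<union> (\<alpha> \<inter> zigzag \<beta> \<gamma> k))\<^sup>*"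
      using zigzag_refl_sym_compatible[OF c(2,3), of k] unfolding zigzag.simps
      by (intro day_path_shift[OF path A order_refl c(1,3) le]) auto
    also have "\<dots> \<subseteq> ((\<gamma> \<union> (\<beta> \<inter> \<alpha>))\<^sup>*)\<^sup>*"
      using Suc by (intro rtrancl_mono) auto
    finally show ?case by simp
  qed auto
  show "\<alpha> \<inter> (\<gamma> \<union> \<beta>)\<^sup>+ \<subseteq> (\<gamma> \<union> (\<beta> \<inter> \<alpha>))\<^sup>+"
  proof (rule subrelI)
    fix a d assume ad: "(a, d) \<in> \<alpha> \<inter> (\<gamma> \<union> \<beta>)\<^sup>+"
    then have "(a, d) \<in> \<alpha> \<inter> (\<Union>k. zigzag \<beta> \<gamma> k)"
      using Union_zigzag[OF c(2,3)] by (simp add: Un_commute)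
    then have "(a, d) \<in> (\<gamma> \<union> (\<beta> \<inter> \<alpha>))\<^sup>*" using * by blast
    moreover have "(a, a) \<in> \<gamma>"
      using ad congruenceD(1)[OF c(1)] congruenceD(2)[OF c(3)] by (auto dest: refl_onD)
    ultimately show "(a, d) \<in> (\<gamma> \<union> (\<beta> \<inter> \<alpha>))\<^sup>+"
      by (metis Un_iff r_into_trancl rtrancl_eq_or_trancl)
  qed
qed

text \<open>A term should be coloured with first coordinate \<open>False\<close> as rarely as possible, that is, only if it
  is \<open>\<alpha>\<close>-related to \<open>x\<close>: the relation \<open>\<gamma>\<close> on the square constrains the second coordinate only
  over such terms.  There the second coordinate has to be constant along \<open>\<gamma>\<close> and \<open>\<alpha> \<inter> \<beta>\<close>,
  starting with \<open>False\<close> at \<open>x\<close>, and it has to depend on the \<open>\<beta>\<close>-class only.\<close>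

definition square_colour ::
    "'f variety \<Rightarrow> ('f, 'a) alg set \<Rightarrow> ('f, bool \<times> bool) trm \<Rightarrow> bool \<times> bool" where
  "square_colour V K t =
     ((Var (False, False), t) \<notin> term_kernel V K alpha_rep,
      \<nexists>t'. (Var (False, False), t') \<in> (day_step V K)\<^sup>* \<and> (t', t) \<in> term_kernel V K beta_rep)"

lemma square_colour_alpha:
  assumes "(s, t) \<in> term_kernel V K alpha_rep"
  shows "alpha_rep (square_colour V K s) = alpha_rep (square_colour V K t)"
  using assms term_kernel_sym[OF assms]
  by (auto simp: square_colour_def alpha_rep_def dest: term_kernel_trans)

lemma square_colour_beta:
  assumes "(s, t) \<in> term_kernel V K beta_rep"
  shows "beta_rep (square_colour V K s) = beta_rep (square_colour V K t)"
  using assms term_kernel_sym[OF assms]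
  by (auto simp: square_colour_def beta_rep_def dest: term_kernel_trans)

text \<open>If \<open>s\<close> has the colour of \<open>x\<close>, then \<open>s\<close> itself is reachable from \<open>x\<close>, not only
  \<open>\<beta>\<close>-related to a reachable term \<open>t'\<close>: both \<open>s\<close> and \<open>t'\<close> are \<open>\<alpha>\<close>-related to \<open>x\<close>.\<close>

lemma square_colour_gamma:
  assumes "(s, t) \<in> term_kernel V K gamma_rep"
  shows "gamma_rep (square_colour V K s) = gamma_rep (square_colour V K t)"
proof -
  have eq: "fst (square_colour V K s) = fst (square_colour V K t)"
    using square_colour_alpha[of s t V K] assms gamma_kernel_alpha[of V K]
    by (auto simp: alpha_rep_def)
  have "\<not> snd (square_colour V K t)"
    if st: "(s, t) \<in> term_kernel V K gamma_rep"
      and s: "\<not> fst (square_colour V K s)" "\<not> snd (square_colour V K s)" for s t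
  proof -
    let ?o = "Var (False, False)"
    from s obtain t' where t': "(?o, t') \<in> (day_step V K)\<^sup>*" "(t', s) \<in> term_kernel V K beta_rep"
      by (auto simp: square_colour_def)
    have "(?o, s) \<in> term_kernel V K alpha_rep" using s by (auto simp: square_colour_def)
    then have "(t', s) \<in> term_kernel V K alpha_rep"
      using day_path_alpha[OF t'(1)] by (blast intro: term_kernel_trans term_kernel_sym)
    then have "(?o, t) \<in> (day_step V K)\<^sup>*"
      using t' st unfolding day_step_def by (meson IntI UnI1 UnI2 rtrancl.rtrancl_into_rtrancl)
    moreover have "(t, t) \<in> term_kernel V K beta_rep"
      using term_kernel_wf[OF st] by (simp add: term_kernel_refl)
    ultimately show ?thesis by (auto simp: square_colour_def)
  qed
  from this[OF assms] this[OF term_kernel_sym[OF assms]] eq show ?thesis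
    by (auto simp: gamma_rep_def)
qed

text \<open>The colour of \<open>u\<close> (and hence of \<open>z\<close>) is right because no path leads from \<open>x\<close> to \<open>u\<close>; the
  two distinct elements \<open>a\<close> and \<open>d\<close> are there to tell \<open>x\<close> from \<open>y\<close>.\<close>

lemma square_colour_Var:
  assumes nopath: "(Var (False, False), Var (False, True)) \<notin> (day_step V K)\<^sup>*"
    and A: "A \<in> K" "a \<in> carrier A" "d \<in> carrier A" "a \<noteq> d"
  shows "square_colour V K (Var p) = p"
proof -
  let ?o = "Var (False, False)"
  have fst: "(?o, Var p) \<in> term_kernel V K alpha_rep \<longleftrightarrow> \<not> fst p"
  proof
    assume "(?o, Var p) \<in> term_kernel V K alpha_rep"
    moreover have "range (\<lambda>q :: bool \<times> bool. if fst q then d else a) \<subseteq> carrier A"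
      using A(2,3) by auto
    ultimately show "\<not> fst p"
      using term_kernelD[OF _ A(1), of "?o" "Var p" V alpha_rep "\<lambda>q. if fst q then d else a"] A(4)
      by (auto simp: alpha_rep_def split: if_splits)
  qed (auto intro!: term_kernel_Var simp: alpha_rep_def)
  have snd: "(\<exists>t'. (?o, t') \<in> (day_step V K)\<^sup>* \<and> (t', Var p) \<in> term_kernel V K beta_rep) \<longleftrightarrow> \<not> snd p"
  proof
    assume "\<not> snd p"
    then have "(?o, Var p) \<in> term_kernel V K beta_rep"
      by (auto intro!: term_kernel_Var simp: beta_rep_def)
    then show "\<exists>t'. (?o, t') \<in> (day_step V K)\<^sup>* \<and> (t', Var p) \<in> term_kernel V K beta_rep" by blast
  next
    let ?u = "Var (False, True)"
    assume "\<exists>t'. (?o, t') \<in> (day_step V K)\<^sup>* \<and> (t', Var p) \<in> term_kernel V K beta_rep"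
    then obtain t' where t': "(?o, t') \<in> (day_step V K)\<^sup>*" "(t', Var p) \<in> term_kernel V K beta_rep"
      by blast
    show "\<not> snd p"
    proof
      assume "snd p"
      then have "(Var p, ?u) \<in> term_kernel V K beta_rep"
        by (intro term_kernel_Var) (simp add: beta_rep_def)
      then have "(t', ?u) \<in> term_kernel V K beta_rep" using t'(2) by (rule term_kernel_trans[rotated])
      moreover have "(?o, ?u) \<in> term_kernel V K alpha_rep"
        by (intro term_kernel_Var) (simp add: alpha_rep_def)
      then have "(t', ?u) \<in> term_kernel V K alpha_rep"
        using day_path_alpha[OF t'(1)] by (blast intro: term_kernel_trans term_kernel_sym)
      ultimately have "(?o, ?u) \<in> (day_step V K)\<^sup>*"
        using t'(1) by (auto simp: day_step_def intro: rtrancl.rtrancl_into_rtrancl)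
      then show False using nopath by contradiction
    qed
  qed
  show ?thesis using fst snd by (cases p) (simp add: square_colour_def)
qed

definition acts_on_square :: "'f variety \<Rightarrow> ('f, bool \<times> bool) alg \<Rightarrow> bool" where
  "acts_on_square V B \<longleftrightarrow> carrier B = UNIV \<and> B \<in> members V \<and>
     compatible V B {(p, q). alpha_rep p = alpha_rep q} \<and>
     compatible V B {(p, q). beta_rep p = beta_rep q} \<and>
     compatible V B {(p, q). gamma_rep p = gamma_rep q}"

lemma not_modular_acts_on_square:
  fixes V :: "'f variety"
  assumes V: "wf_variety V" "defined_by_height_le_1 V"
    and non: "\<not> congruence_modular TYPE('a) V"
  shows "\<exists>B. acts_on_square V B"
proof -
  let ?K = "members V :: ('f, 'a) alg set"
  obtain A :: "('f, 'a) alg" where A: "A \<in> ?K" and nmod: "\<not> modular (congruence_lattice V A)"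
    using non by (auto simp: congruence_modular_def)
  have nopath: "(Var (False, False), Var (False, True)) \<notin> (day_step V ?K)\<^sup>*"
    using day_path_modular A nmod by blast
  have "\<exists>a d. a \<in> carrier A \<and> d \<in> carrier A \<and> a \<noteq> d"
  proof (rule ccontr)
    assume "\<not> ?thesis"
    then have one: "\<And>a d. a \<in> carrier A \<Longrightarrow> d \<in> carrier A \<Longrightarrow> a = d" by blast
    have "modular (congruence_lattice V A)"
      unfolding modular_congruence_lattice_iff[OF A]
    proof (intro ballI impI subrelI)
      fix \<alpha> \<beta> \<gamma> a d
      assume c: "\<alpha> \<in> congruences V A" "\<gamma> \<in> congruences V A" and ad: "(a, d) \<in> \<alpha> \<inter> (\<gamma> \<union> \<beta>)\<^sup>+"
      then have "a \<in> carrier A" "a = d" using congruenceD(1)[OF c(1)] one by auto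
      then have "(a, d) \<in> \<gamma>" using congruenceD(2)[OF c(2)] by (auto dest: refl_onD)
      then show "(a, d) \<in> (\<gamma> \<union> (\<beta> \<inter> \<alpha>))\<^sup>+" by blast
    qed
    then show False using nmod by contradiction
  qed
  then obtain a d where "a \<in> carrier A" "d \<in> carrier A" "a \<noteq> d" by blast
  then have Var: "square_colour V ?K (Var p) = p" for p
    using square_colour_Var[OF nopath A] by blast
  have inv: "square_colour V ?K s = square_colour V ?K t" if "(s, t) \<in> term_kernel V ?K id" for s t
  proof -
    have "(s, t) \<in> term_kernel V ?K alpha_rep" "(s, t) \<in> term_kernel V ?K beta_rep"
      using that term_kernel_id by blast+
    then show ?thesis
      using square_colour_alpha[of s t V ?K] square_colour_beta[of s t V ?K]
      by (simp add: alpha_rep_def beta_rep_def prod_eq_iff)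
  qed
  have "acts_on_square V (reflection (square_colour V ?K))"
    unfolding acts_on_square_def
    by (intro conjI carrier_reflection reflection_member[OF V order_refl Var] reflection_compatible
        inv square_colour_alpha square_colour_beta square_colour_gamma)
  then show ?thesis by blast
qed

section \<open>Failure of permutability gives monotone operations\<close>

text \<open>The subalgebra of the square of the free algebra on \<open>False\<close> and \<open>True\<close> generated by the pairs
  \<open>(a, b)\<close> with \<open>a \<le> b\<close>.  The generators are the variables \<open>(a, b)\<close> of the term \<open>p\<close>, and its
  two coordinates are obtained by renaming.  Conjunction and disjunction are the coordinate maps on
  these pairs, and they send the pair \<open>(True, False)\<close>, which is not in the order, to those of
  \<open>(False, True)\<close>; so every term \<open>p\<close> may be admitted.\<close>

definition hm_step :: "'f variety \<Rightarrow> ('f, 'a) alg set \<Rightarrow> (('f, bool) trm \<times> ('f, bool) trm) set" where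
  "hm_step V K = {(s, t). wf_trm V s \<and> wf_trm V t \<and>
     (\<exists>p :: ('f, bool \<times> bool) trm. wf_trm V p \<and> (\<forall>A \<in> K. \<forall>\<sigma>. range \<sigma> \<subseteq> carrier A \<longrightarrow>
        eval A (\<sigma> \<circ> (\<lambda>(a, b). a \<and> b)) p = eval A \<sigma> s \<and>
        eval A (\<sigma> \<circ> (\<lambda>(a, b). a \<or> b)) p = eval A \<sigma> t))}"

lemma hm_stepI:
  fixes K :: "('f, 'a) alg set"
  assumes "wf_trm V p" "\<And>a b. (a, b) \<in> trm_vars p \<Longrightarrow> a \<le> b"
  shows "(map_trm id fst p, map_trm id snd p) \<in> hm_step V K"
proof -
  have le: "b" if "(a, b) \<in> trm_vars p" "a" for a b
    using assms(2)[OF that(1)] that(2) by simp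
  have "eval A (\<sigma> \<circ> (\<lambda>(a, b). a \<and> b)) p = eval A \<sigma> (map_trm id fst p)"
    "eval A (\<sigma> \<circ> (\<lambda>(a, b). a \<or> b)) p = eval A \<sigma> (map_trm id snd p)" 
    for A :: "('f, 'a) alg" and \<sigma>
  proof -
    have "map_trm id fst p = map_trm id (\<lambda>(a, b). a \<and> b) p"
      by (intro trm.map_cong) (auto dest: le)
    moreover have "map_trm id snd p = map_trm id (\<lambda>(a, b). a \<or> b) p"
      by (intro trm.map_cong) (auto dest: le)
    ultimately show "eval A (\<sigma> \<circ> (\<lambda>(a, b). a \<and> b)) p = eval A \<sigma> (map_trm id fst p)"
      "eval A (\<sigma> \<circ> (\<lambda>(a, b). a \<or> b)) p = eval A \<sigma> (map_trm id snd p)"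
      by (simp_all add: eval_map_trm[where A = A and h = id])
  qed
  then show ?thesis using assms(1) unfolding hm_step_def by auto
qed

lemma term_kernel_hm_step:
  assumes "(s, t) \<in> term_kernel V K id"
  shows "(s, t) \<in> hm_step V K"
proof -
  have wf: "wf_trm V s" "wf_trm V t" using term_kernel_wf[OF assms] by auto
  define p where "p = map_trm id (\<lambda>b :: bool. (b, b)) s"
  have "(map_trm id fst p, map_trm id snd p) \<in> hm_step V K"
    by (rule hm_stepI) (auto simp: p_def wf trm.set_map)
  then have "(s, s) \<in> hm_step V K"
    by (simp add: p_def trm.map_comp comp_def id_def[symmetric] trm.map_id)
  then show ?thesis
    using wf(2) assms by (auto simp: hm_step_def term_kernel_def)
qed

text \<open>The Hagemann--Mitschke argument, walking backwards along a path.  Write \<open>t(a, b)\<close> for the value of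
  \<open>t\<close> with \<open>False\<close> sent to \<open>a\<close> and \<open>True\<close> to \<open>b\<close>.  The last step, from \<open>t'\<close> to \<open>t\<close>, is given by
  a term \<open>p\<close>, ternary in effect, with \<open>t(a, b) = p(a, b, b)\<close> and \<open>t'(b, b') = p(b, b, b')\<close>.  Both are linked to
  \<open>p(a, b, b')\<close>, the former by \<open>\<delta>'\<close> and the latter by \<open>\<delta>\<close>.  The \<open>\<delta>\<close>-link merges with the first
  link of the chain from \<open>t'(b, b')\<close>, so each step costs only one factor.\<close>

lemma hm_path_alternate:
  fixes V :: "'f variety"
  assumes "(Var True, t) \<in> hm_step V K ^^ l" "A \<in> K"
    and "\<delta> \<in> congruences V A" "\<delta>' \<in> congruences V A"
    and "(a, b) \<in> \<delta>" "(b, c) \<in> alternate l \<delta>' \<delta>"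
  shows "(eval A (\<lambda>v. if v then b else a) t, c) \<in> alternate (Suc l) \<delta>' \<delta>"
  using assms(1,3-)
proof (induction l arbitrary: t \<delta> \<delta>' a b)
  case 0
  then have "b \<in> carrier A" using congruenceD(1)[OF 0(2)] by auto
  then show ?case using 0 congruenceD(2)[OF 0(3)] by (auto dest: refl_onD)
next
  case (Suc l)
  obtain t' where t': "(Var True, t') \<in> hm_step V K ^^ l" "(t', t) \<in> hm_step V K"
    using Suc.prems(1) by auto
  obtain b' where b': "(b, b') \<in> \<delta>'" "(b', c) \<in> alternate l \<delta> \<delta>'"
    using Suc.prems(5) by auto
  note d = congruenceD[OF Suc.prems(2)] and d' = congruenceD[OF Suc.prems(3)]
  have car: "a \<in> carrier A" "b \<in> carrier A" "b' \<in> carrier A"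
    using Suc.prems(4) b'(1) d(1) d'(1) by auto
  obtain p :: "('f, bool \<times> bool) trm" where wf: "wf_trm V p" and
    p: "\<And>\<sigma>. range \<sigma> \<subseteq> carrier A \<Longrightarrow> eval A (\<sigma> \<circ> (\<lambda>(a, b). a \<and> b)) p = eval A \<sigma> t'"
       "\<And>\<sigma>. range \<sigma> \<subseteq> carrier A \<Longrightarrow> eval A (\<sigma> \<circ> (\<lambda>(a, b). a \<or> b)) p = eval A \<sigma> t"
    using t'(2) assms(2) unfolding hm_step_def by blast
  let ?e = "\<lambda>a b. eval A (\<lambda>v. if v then b else a)"
  define \<tau> where "\<tau> = (\<lambda>(x, y). if x \<and> y then b' else if x \<or> y then b else a)"
  have refl: "(u, u) \<in> \<delta>" "(u, u) \<in> \<delta>'" if "u \<in> carrier A" for u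
    using that d(2) d'(2) by (auto dest: refl_onD)
  have range_if: "range (\<lambda>v :: bool. if v then y else x) \<subseteq> carrier A"
    if "y \<in> carrier A" "x \<in> carrier A" for x y
    using that by auto
  have "(eval A ((\<lambda>v. if v then b else a) \<circ> (\<lambda>(a, b). a \<or> b)) p, eval A \<tau> p) \<in> \<delta>'"
  proof (rule eval_compatible[OF d'(5) wf])
    show "(((\<lambda>v. if v then b else a) \<circ> (\<lambda>(a, b). a \<or> b)) q, \<tau> q) \<in> \<delta>'" for q
      using b'(1) refl car by (cases "fst q"; cases "snd q") (auto simp: \<tau>_def case_prod_beta)
  qed
  then have 1: "(?e a b t, eval A \<tau> p) \<in> \<delta>'"
    using p(2)[OF range_if[OF car(2,1)]] by simp
  have "(eval A \<tau> p, eval A ((\<lambda>v. if v then b' else b) \<circ> (\<lambda>(a, b). a \<and> b)) p) \<in> \<delta>"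
  proof (rule eval_compatible[OF d(5) wf])
    show "(\<tau> q, ((\<lambda>v. if v then b' else b) \<circ> (\<lambda>(a, b). a \<and> b)) q) \<in> \<delta>" for q
      using Suc.prems(4) refl car by (cases "fst q"; cases "snd q") (auto simp: \<tau>_def case_prod_beta)
  qed
  then have 2: "(eval A \<tau> p, ?e b b' t') \<in> \<delta>"
    using p(1)[OF range_if[OF car(3,2)]] by simp
  have "(?e b b' t', c) \<in> alternate (Suc l) \<delta> \<delta>'"
    using Suc.IH[OF t'(1) Suc.prems(3,2) b'] .
  then have "(eval A \<tau> p, c) \<in> alternate (Suc l) \<delta> \<delta>'"
    using 2 d(4) by (auto dest: transD)
  then show ?case using 1 by auto
qed

text \<open>For \<open>t = False\<close> the chain of \<open>hm_path_alternate\<close> starts at \<open>a\<close> itself and begins with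
  the other congruence.\<close>

lemma hm_path_permutable:
  fixes V :: "'f variety"
  assumes "(Var True, Var False) \<in> (hm_step V (members V :: ('f, 'a) alg set))\<^sup>*"
  shows "\<exists>n\<ge>2. congruence_permutable TYPE('a) n V"
proof -
  let ?K = "members V :: ('f, 'a) alg set"
  obtain l where l: "(Var True, Var False) \<in> hm_step V ?K ^^ l"
    using assms rtrancl_imp_relpow by blast
  \<comment> \<open>Lengthening the path by a trivial step makes the number of factors at least two.\<close>
  moreover have "(Var False, Var False) \<in> hm_step V ?K"
    by (intro term_kernel_hm_step term_kernel_refl) simp
  ultimately have path: "(Var True, Var False) \<in> hm_step V ?K ^^ Suc l" by auto
  have "alternate (Suc (Suc l)) \<alpha> \<beta> \<subseteq> alternate (Suc (Suc l)) \<beta> \<alpha>"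
    if "A \<in> ?K" "\<alpha> \<in> congruences V A" "\<beta> \<in> congruences V A" for A \<alpha> \<beta>
  proof (rule subrelI)
    fix a c assume "(a, c) \<in> alternate (Suc (Suc l)) \<alpha> \<beta>"
    then obtain b where "(a, b) \<in> \<alpha>" "(b, c) \<in> alternate (Suc l) \<beta> \<alpha>"
      by (subst (asm) alternate.simps) blast
    from hm_path_alternate[OF path that this] show "(a, c) \<in> alternate (Suc (Suc l)) \<beta> \<alpha>"
      by (simp only: eval.simps if_False)
  qed
  then have "congruence_permutable TYPE('a) (Suc (Suc l)) V"
    unfolding congruence_permutable_def by (metis subset_antisym)
  then show ?thesis by (intro exI[of _ "Suc (Suc l)"]) simp
qed

definition acts_monotonically :: "'f variety \<Rightarrow> ('f, bool) alg \<Rightarrow> bool" where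
  "acts_monotonically V B \<longleftrightarrow> carrier B = UNIV \<and> B \<in> members V \<and> compatible V B {(p, q). p \<le> q}"

text \<open>The colouring is the membership in the up-set of \<open>True\<close>.  It sends \<open>False\<close> to \<open>False\<close> exactly
  because there is no path from \<open>True\<close> to \<open>False\<close>.\<close>

lemma not_permutable_acts_monotonically:
  fixes V :: "'f variety"
  assumes V: "wf_variety V" "defined_by_height_le_1 V"
    and non: "\<forall>n\<ge>2. \<not> congruence_permutable TYPE('a) n V"
  shows "\<exists>B. acts_monotonically V B"
proof -
  let ?K = "members V :: ('f, 'a) alg set"
  define c where "c t \<longleftrightarrow> (Var True, t) \<in> (hm_step V ?K)\<^sup>*" for t
  have step: "c s \<le> c t" if "(s, t) \<in> hm_step V ?K" for s t
    using that by (auto simp: c_def intro: rtrancl.rtrancl_into_rtrancl)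
  have Var: "c (Var p) = p" for p
    using hm_path_permutable[where V = V and 'a = 'a] non by (cases p) (auto simp: c_def)
  have inv: "c s = c t" if "(s, t) \<in> term_kernel V ?K id" for s t
    using step term_kernel_hm_step that term_kernel_sym[OF that] by (metis order_antisym)
  have "compatible V (reflection c) {(p, q). p \<le> q}"
    unfolding compatible_def
  proof (intro ballI allI impI; elim conjE)
    fix f and ps qs :: "bool list"
    assume f: "f \<in> symbols V" "length ps = arity V f"
      and le: "list_all2 (\<lambda>p q. (p, q) \<in> {(p, q). p \<le> q}) ps qs"
    let ?p = "Fun f (map Var (zip ps qs))"
    have len: "length ps = length qs" using le by (rule list_all2_lengthD)
    have "(map_trm id fst ?p, map_trm id snd ?p) \<in> hm_step V ?K"
      using f len le by (intro hm_stepI) (auto simp: list_all2_iff)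
    then have "(Fun f (map Var ps), Fun f (map Var qs)) \<in> hm_step V ?K"
      using len by (simp add: comp_def flip: map_map[of Var fst, unfolded comp_def] map_map[of Var snd, unfolded comp_def])
    then show "(oper (reflection c) f ps, oper (reflection c) f qs) \<in> {(p, q). p \<le> q}"
      using step by (simp add: reflection_def)
  qed
  then have "acts_monotonically V (reflection c)"
    unfolding acts_monotonically_def
    by (intro conjI carrier_reflection reflection_member[OF V order_refl Var inv])
  then show ?thesis by blast
qed

section \<open>Joins and subpowers\<close>

definition join_alg :: "('f, 'p) alg \<Rightarrow> ('g, 'p) alg \<Rightarrow> ('f + 'g, 'p) alg" where
  "join_alg A B = \<lparr>carrier = carrier A, oper = case_sum (oper A) (oper B)\<rparr>"

lemma join_alg_simps [simp]:
  "carrier (join_alg A B) = carrier A"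
  "oper (join_alg A B) (Inl f) = oper A f"
  "oper (join_alg A B) (Inr g) = oper B g"
  by (simp_all add: join_alg_def)

lemma variety_join_simps [simp]:
  "symbols (variety_join V W) = symbols V <+> symbols W"
  "arity (variety_join V W) (Inl f) = arity V f"
  "arity (variety_join V W) (Inr g) = arity W g"
  by (simp_all add: variety_join_def)

lemma identities_variety_join:
  "e \<in> identities (variety_join V W) \<longleftrightarrow>
     (\<exists>(s, t) \<in> identities V. e = (map_trm Inl id s, map_trm Inl id t)) \<or>
     (\<exists>(s, t) \<in> identities W. e = (map_trm Inr id s, map_trm Inr id t))"
  by (auto simp: variety_join_def)

lemma wf_variety_join:
  assumes "wf_variety V" "wf_variety W"
  shows "wf_variety (variety_join V W)"
proof -
  have "wf_trm (variety_join V W) (map_trm Inl id s) \<longleftrightarrow> wf_trm V s" for s :: "('a, nat) trm"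
    by (induction s) auto
  moreover have "wf_trm (variety_join V W) (map_trm Inr id s) \<longleftrightarrow> wf_trm W s" for s :: "('b, nat) trm"
    by (induction s) auto
  ultimately show ?thesis
    using assms unfolding wf_variety_def by (auto 0 3 simp: identities_variety_join dest: bspec)
qed

lemma join_alg_member:
  fixes A :: "('f, 'p) alg" and B :: "('g, 'p) alg"
  assumes "A \<in> members V" "B \<in> members W" "carrier B = carrier A"
  shows "join_alg A B \<in> members (variety_join V W)"
proof -
  have "eval (join_alg A B) \<sigma> (map_trm Inl id s) = eval A \<sigma> s"
    "eval (join_alg A B) \<sigma> (map_trm Inr id t) = eval B \<sigma> t"
    for \<sigma> :: "nat \<Rightarrow> 'p" and s t
    using eval_map_trm[of "join_alg A B" Inl A \<sigma> id s] eval_map_trm[of "join_alg A B" Inr B \<sigma> id t]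
    by simp_all
  then have "satisfies (join_alg A B) e" if "e \<in> identities (variety_join V W)" for e
    using that assms unfolding identities_variety_join members_def satisfies_def by fastforce
  then show ?thesis
    using assms unfolding members_def by auto
qed

lemma join_alg_compatible:
  assumes "compatible V A R" "compatible W B R"
  shows "compatible (variety_join V W) (join_alg A B) R"
  using assms unfolding compatible_def by auto

text \<open>A subalgebra, with carrier \<open>C\<close>, of the power of \<open>B\<close> with exponent \<open>I\<close>; the function \<open>e x\<close>
  is the tuple that the element \<open>x\<close> stands for.  Elements are kept separate from tuples so that the
  carrier can be a set of terms.\<close>

definition subpower :: "('f, 'p) alg \<Rightarrow> 'i set \<Rightarrow> ('d \<Rightarrow> 'i \<Rightarrow> 'p) \<Rightarrow> 'd set \<Rightarrow> ('f, 'd) alg" where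
  "subpower B I e C = \<lparr>carrier = C,
     oper = (\<lambda>f xs. SOME z. z \<in> C \<and> (\<forall>i\<in>I. e z i = oper B f (map (\<lambda>x. e x i) xs)))\<rparr>"

locale subpower_of =
  fixes V :: "'f variety" and B :: "('f, 'p) alg" and I :: "'i set"
    and e :: "'d \<Rightarrow> 'i \<Rightarrow> 'p" and C :: "'d set"
  assumes B: "B \<in> members V" and univ: "carrier B = UNIV" and ne: "C \<noteq> {}"
    and sep: "\<And>x y. x \<in> C \<Longrightarrow> y \<in> C \<Longrightarrow> (\<And>i. i \<in> I \<Longrightarrow> e x i = e y i) \<Longrightarrow> x = y"
    and closed: "\<And>f xs. f \<in> symbols V \<Longrightarrow> length xs = arity V f \<Longrightarrow> set xs \<subseteq> C \<Longrightarrow>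
      \<exists>z\<in>C. \<forall>i\<in>I. e z i = oper B f (map (\<lambda>x. e x i) xs)"
begin

abbreviation "S \<equiv> subpower B I e C"

lemma carrier_subpower [simp]: "carrier S = C"
  by (simp add: subpower_def)

lemma oper_subpower:
  assumes "f \<in> symbols V" "length xs = arity V f" "set xs \<subseteq> C"
  shows "oper S f xs \<in> C \<and> (\<forall>i\<in>I. e (oper S f xs) i = oper B f (map (\<lambda>x. e x i) xs))"
  using someI_ex[of "\<lambda>z. z \<in> C \<and> (\<forall>i\<in>I. e z i = oper B f (map (\<lambda>x. e x i) xs))"] closed[OF assms]
  by (auto simp: subpower_def)

lemma eval_subpower:
  assumes "range \<sigma> \<subseteq> C" "wf_trm V t"
  shows "eval S \<sigma> t \<in> C \<and> (\<forall>i\<in>I. e (eval S \<sigma> t) i = eval B (\<lambda>v. e (\<sigma> v) i) t)"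
  using assms(2)
proof (induction t)
  case (Fun f ts)
  then have "set (map (eval S \<sigma>) ts) \<subseteq> C" by auto
  from oper_subpower[OF _ _ this, of f] Fun show ?case
    by (auto simp: comp_def intro!: arg_cong[where f = "oper B f"])
qed (use assms(1) in auto)

lemma subpower_member:
  assumes "wf_variety V"
  shows "S \<in> members V"
proof -
  have "eval S \<sigma> s = eval S \<sigma> t" if "(s, t) \<in> identities V" "range \<sigma> \<subseteq> C" for s t \<sigma>
  proof -
    have wf: "wf_trm V s" "wf_trm V t" using assms that(1) by (auto simp: wf_variety_def)
    have "eval B \<tau> s = eval B \<tau> t" for \<tau>
      using B univ that(1) by (fastforce simp: members_def satisfies_def)
    then show ?thesis
      using eval_subpower[OF that(2) wf(1)] eval_subpower[OF that(2) wf(2)] by (intro sep) auto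
  qed
  then show ?thesis using ne oper_subpower by (auto simp: members_def satisfies_def)
qed

lemma subpower_congruence:
  assumes "J \<subseteq> I" and \<theta>: "equiv UNIV \<theta>" "compatible V B \<theta>"
  shows "{(x, y). x \<in> C \<and> y \<in> C \<and> (\<forall>i\<in>J. (e x i, e y i) \<in> \<theta>)} \<in> congruences V S" (is "?\<theta> \<in> _")
proof -
  have "refl_on C ?\<theta>" "sym ?\<theta>" "trans ?\<theta>" "?\<theta> \<subseteq> C \<times> C"
    using \<theta>(1) unfolding equiv_def refl_on_def sym_def trans_def by blast+
  moreover have "compatible V S ?\<theta>"
    unfolding compatible_def
  proof (intro ballI allI impI; elim conjE)
    fix f xs ys
    assume f: "f \<in> symbols V" "length xs = arity V f" and xy: "list_all2 (\<lambda>x y. (x, y) \<in> ?\<theta>) xs ys"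
    then have ys: "length ys = arity V f" by (auto dest: list_all2_lengthD)
    have C: "set xs \<subseteq> C" "set ys \<subseteq> C"
      using xy by (auto simp: list_all2_conv_all_nth in_set_conv_nth)
    have "(oper B f (map (\<lambda>x. e x i) xs), oper B f (map (\<lambda>x. e x i) ys)) \<in> \<theta>" if "i \<in> J" for i
    proof -
      have "list_all2 (\<lambda>x y. (x, y) \<in> \<theta>) (map (\<lambda>x. e x i) xs) (map (\<lambda>x. e x i) ys)"
        using xy that by (auto simp: list_all2_map1 list_all2_map2 elim!: list_all2_mono)
      then show ?thesis using \<theta>(2) f by (simp add: compatible_def)
    qed
    then show "(oper S f xs, oper S f ys) \<in> ?\<theta>"
      using oper_subpower[OF f C(1)] oper_subpower[OF f(1) ys C(2)] assms(1) by (auto simp: subset_iff)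
  qed
  ultimately show ?thesis by (auto simp: congruence_iff equiv_def)
qed

end

section \<open>Witnesses over terms\<close>

lemma equiv_kernel: "equiv UNIV {(p, q). w p = w q}"
  by (auto simp: equiv_def refl_on_def sym_def trans_def)

text \<open>The square, copied into the type of terms as a subpower with one-point exponent.  Since
  \<open>\<alpha> \<inter> \<beta>\<close> is the equality, \<open>\<gamma> \<or> (\<alpha> \<and> \<beta>) = \<gamma>\<close>; but \<open>\<gamma> \<or> \<beta>\<close> connects \<open>x\<close> and
  \<open>u\<close> by way of \<open>y\<close> and \<open>z\<close>.\<close>

lemma acts_on_square_not_modular:
  fixes V :: "'f variety"
  assumes V: "wf_variety V" and act: "acts_on_square V B"
  shows "\<not> congruence_modular TYPE(('f, nat) trm) V"
proof -
  define j :: "bool \<times> bool \<Rightarrow> ('f, nat) trm" where "j p = Var (to_nat p)" for p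
  have "inj j" by (auto simp: j_def inj_def)
  define e where "e x i = inv j x" for x and i :: unit
  have e: "e (j p) i = p" for p i using \<open>inj j\<close> by (simp add: e_def)
  interpret subpower_of V B UNIV e "range j"
    using act by unfold_locales (auto simp: acts_on_square_def e)
  define ker where "ker w = {(x, y). x \<in> range j \<and> y \<in> range j \<and>
      (\<forall>i\<in>UNIV. (e x i, e y i) \<in> {(p, q). w p = w q})}" for w :: "bool \<times> bool \<Rightarrow> bool \<times> bool"
  have c: "ker alpha_rep \<in> congruences V S" "ker beta_rep \<in> congruences V S"
      "ker gamma_rep \<in> congruences V S"
    unfolding ker_def using act
    by (intro subpower_congruence equiv_kernel; simp add: acts_on_square_def)+
  have ker: "(j p, j q) \<in> ker w \<longleftrightarrow> w p = w q" for p q w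
    by (simp add: ker_def e)
  have le: "ker gamma_rep \<subseteq> ker alpha_rep" "ker beta_rep \<inter> ker alpha_rep \<subseteq> ker gamma_rep"
    by (auto simp: ker_def e rep_defs)
  have "trans (ker gamma_rep)" using congruenceD(4)[OF c(3)] .
  then have "(ker gamma_rep \<union> (ker beta_rep \<inter> ker alpha_rep))\<^sup>+ = ker gamma_rep"
    using le(2) by (simp add: sup.absorb1 trancl_id)
  moreover have "(j (False, False), j (False, True)) \<in> ker alpha_rep"
      "(j (False, False), j (False, True)) \<notin> ker gamma_rep"
    by (auto simp: ker rep_defs)
  moreover have "(j (False, False), j (False, True)) \<in> (ker gamma_rep \<union> ker beta_rep)\<^sup>+"
  proof -
    have "(j (False, False), j (True, False)) \<in> ker beta_rep"
        "(j (True, False), j (True, True)) \<in> ker gamma_rep"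
        "(j (True, True), j (False, True)) \<in> ker beta_rep"
      by (simp_all add: ker rep_defs)
    then show ?thesis by (meson UnI1 UnI2 trancl.simps)
  qed
  ultimately have "\<not> modular (congruence_lattice V S)"
    using c le(1) unfolding modular_congruence_lattice_iff[OF subpower_member[OF V]] by blast
  then show ?thesis
    using subpower_member[OF V] unfolding congruence_modular_def by blast
qed

lemma antitone_threshold:
  assumes "\<And>i j. i < j \<Longrightarrow> j < n \<Longrightarrow> P j \<Longrightarrow> P i"
  shows "\<exists>k\<le>n. \<forall>i<n. P i \<longleftrightarrow> i < (k::nat)"
proof -
  define k where "k = (LEAST k. k = n \<or> \<not> P k)"
  have le: "k \<le> n" unfolding k_def by (intro Least_le) simp
  have below: "P i" if "i < k" for i using not_less_Least[of i] that unfolding k_def by blast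
  have stop: "k = n \<or> \<not> P k" unfolding k_def by (rule LeastI[of _ n]) simp
  have "i < k" if "i < n" "P i" for i
  proof (rule ccontr)
    assume "\<not> i < k"
    then have "k < i \<or> k = i" by auto
    then show False using assms[of k i] stop that by auto
  qed
  then show ?thesis using le below by blast
qed

text \<open>The number \<open>k \<le> n\<close> stands for the tuple of \<open>k\<close> times \<open>True\<close> followed by \<open>n - k\<close> times
  \<open>False\<close>.  Monotone operations applied to decreasing tuples give decreasing tuples, so these form
  a subalgebra.  Agreement on the even coordinates and agreement on the odd coordinates are two
  congruences; neighbours \<open>k\<close> and \<open>k + 1\<close> are related by the one that ignores coordinate
  \<open>k\<close>.  To get from \<open>0\<close> to \<open>n\<close> in \<open>n\<close> factors, each factor has to advance by one, so one has
  to start with the congruence that ignores coordinate \<open>0\<close>.\<close>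

lemma acts_monotonically_not_permutable:
  fixes V :: "'f variety"
  assumes V: "wf_variety V" and act: "acts_monotonically V B" and n: "n \<ge> 1"
  shows "\<not> congruence_permutable TYPE(('f, nat) trm) n V"
proof -
  have mon: "compatible V B {(p, q). p \<le> q}"
    using act by (simp only: acts_monotonically_def)
  define C where "C = (Var ` {..n} :: ('f, nat) trm set)"
  define e where "e x i = (case x of Var k \<Rightarrow> i < k | _ \<Rightarrow> False)" for x :: "('f, nat) trm" and i
  have e [simp]: "e (Var k) i \<longleftrightarrow> i < k" for k i by (simp add: e_def)
  interpret subpower_of V B "{..<n}" e C
  proof
    show "B \<in> members V" "carrier B = UNIV" using act by (auto simp: acts_monotonically_def)
    show "C \<noteq> {}" by (auto simp: C_def)
    show "x = y" if xy: "x \<in> C" "y \<in> C" and eq: "\<And>i. i \<in> {..<n} \<Longrightarrow> e x i = e y i" for x y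
    proof -
      obtain k l where kl: "x = Var k" "y = Var l" "k \<le> n" "l \<le> n"
        using xy unfolding C_def by blast
      have "k \<le> l" using eq[of l] kl by force
      moreover have "l \<le> k" using eq[of k] kl by force
      ultimately show ?thesis using kl by simp
    qed
  next
    fix f and xs :: "('f, nat) trm list"
    assume f: "f \<in> symbols V" "length xs = arity V f" and xs: "set xs \<subseteq> C"
    let ?P = "\<lambda>i. oper B f (map (\<lambda>x. e x i) xs)"
    have "?P j \<le> ?P i" if "i < j" for i j
    proof -
      have "list_all2 (\<lambda>p q. (p, q) \<in> {(p, q). p \<le> q}) (map (\<lambda>x. e x j) xs) (map (\<lambda>x. e x i) xs)"
        using xs that by (auto simp: C_def list_all2_map1 list_all2_map2 intro!: list.rel_refl_strong)
      from compatibleD[OF mon f(1) _ this] f(2) show ?thesis by simp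
    qed
    then obtain k where k: "k \<le> n" "\<And>i. i < n \<Longrightarrow> ?P i \<longleftrightarrow> i < k"
      using antitone_threshold[of n ?P] by (auto simp: le_bool_def)
    then show "\<exists>z\<in>C. \<forall>i\<in>{..<n}. e z i = ?P i"
      by (intro bexI[of _ "Var k"]) (auto simp: C_def)
  qed
  \<comment> \<open>\<open>D j\<close> ignores the coordinates of the parity of \<open>j\<close>.\<close>
  define D where "D j = {(x, y). x \<in> C \<and> y \<in> C \<and>
      (\<forall>i\<in>{i. i < n \<and> (odd i \<longleftrightarrow> even j)}. (e x i, e y i) \<in> {(p, q). id p = id q})}" for j :: nat
  have cong: "D j \<in> congruences V S" for j
    unfolding D_def
  proof (intro subpower_congruence equiv_kernel)
    show "compatible V B {(p, q). id p = id q}"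
      unfolding compatible_def by (auto simp: list.rel_eq[unfolded fun_eq_iff, simplified])
  qed auto
  have D_Suc: "D (Suc (Suc j)) = D j" for j by (simp add: D_def)
  have up: "(Var k, Var (k + m)) \<in> alternate m (D k) (D (Suc k))" if "k + m \<le> n" for k m
    using that
  proof (induction m arbitrary: k)
    case (Suc m)
    then have "(Var k, Var (Suc k)) \<in> D k"
      by (auto simp: D_def C_def less_Suc_eq)
    moreover have "(Var (Suc k), Var (Suc k + m)) \<in> alternate m (D (Suc k)) (D k)"
      using Suc.IH[of "Suc k"] Suc.prems by (simp add: D_Suc)
    ultimately show ?case by auto
  qed simp
  \<comment> \<open>Since \<open>D j\<close> preserves coordinate \<open>j + 1\<close>, it does not lead from below
      \<open>j + 1\<close> to beyond it.\<close>
  have bound: "l \<le> j + m" if "(Var k, Var l) \<in> alternate m (D j) (D (Suc j))" "k \<le> j" for k l j m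
    using that
  proof (induction m arbitrary: k j)
    case (Suc m)
    then obtain y where y: "(Var k, y) \<in> D j" "(y, Var l) \<in> alternate m (D (Suc j)) (D j)" by auto
    then obtain k' where k': "y = Var k'" "k' \<le> n" by (auto simp: D_def C_def)
    have "k' \<le> Suc j"
    proof (rule ccontr)
      assume "\<not> k' \<le> Suc j"
      then have "e (Var k) (Suc j) = e (Var k') (Suc j)"
        using y(1) k' by (auto simp: D_def)
      then show False using \<open>\<not> k' \<le> Suc j\<close> Suc.prems(2) by simp
    qed
    then show ?case using Suc.IH[of k' "Suc j"] y(2) k' by (simp add: D_Suc)
  qed auto
  have "(Var 0, Var n) \<in> alternate n (D 0) (D 1)" using up[of 0 n] by simp
  moreover have "(Var 0, Var n) \<notin> alternate n (D 1) (D 0)"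
  proof
    \<comment> \<open>The first factor preserves coordinate \<open>0\<close> and does not leave \<open>0\<close>; the remaining
        \<open>n - 1\<close> factors are too few.\<close>
    obtain m where m: "n = Suc m" using n by (cases n) auto
    assume "(Var 0, Var n) \<in> alternate n (D 1) (D 0)"
    then obtain y where y: "(Var 0, y) \<in> D 1" "(y, Var n) \<in> alternate m (D 0) (D 1)"
      by (auto simp: m)
    then obtain k where k: "y = Var k" "k \<le> n" by (auto simp: D_def C_def)
    have "e (Var 0) 0 = e y 0" using y(1) n by (auto simp: D_def)
    then have "k = 0" using k by simp
    then show False using bound[of k n m 0] y(2) k m by simp
  qed
  ultimately have "alternate n (D 0) (D 1) \<noteq> alternate n (D 1) (D 0)" by blast
  then show ?thesis
    using subpower_member[OF V] cong unfolding congruence_permutable_def by blast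
qed

theorem theorem1p12:
  fixes V :: "'f variety" and W :: "'g variety"
  assumes "wf_variety V" and "defined_by_height_le_1 V"
    and "wf_variety W" and "defined_by_height_le_1 W"
  shows "(\<not> congruence_modular TYPE('a) V \<and> \<not> congruence_modular TYPE('b) W \<longrightarrow>
            \<not> congruence_modular TYPE(('f + 'g, nat) trm) (variety_join V W)) \<and>
         ((\<forall>n\<ge>2. \<not> congruence_permutable TYPE('a) n V) \<and>
          (\<forall>n\<ge>2. \<not> congruence_permutable TYPE('b) n W) \<longrightarrow>
            (\<forall>n\<ge>2. \<not> congruence_permutable TYPE(('f + 'g, nat) trm) n (variety_join V W)))"
proof (intro conjI impI allI)
  note wf = wf_variety_join[OF assms(1,3)]
  assume "\<not> congruence_modular TYPE('a) V \<and> \<not> congruence_modular TYPE('b) W"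
  then obtain A B where "acts_on_square V A" "acts_on_square W B"
    using not_modular_acts_on_square[OF assms(1,2)] not_modular_acts_on_square[OF assms(3,4)] by blast
  then have "acts_on_square (variety_join V W) (join_alg A B)"
    unfolding acts_on_square_def by (auto simp: join_alg_member join_alg_compatible)
  then show "\<not> congruence_modular TYPE(('f + 'g, nat) trm) (variety_join V W)"
    by (rule acts_on_square_not_modular[OF wf])
next
  note wf = wf_variety_join[OF assms(1,3)]
  fix n :: nat assume "2 \<le> n"
  assume "(\<forall>n\<ge>2. \<not> congruence_permutable TYPE('a) n V) \<and> (\<forall>n\<ge>2. \<not> congruence_permutable TYPE('b) n W)"
  then obtain A B where "acts_monotonically V A" "acts_monotonically W B"
    using not_permutable_acts_monotonically[OF assms(1,2)]
      not_permutable_acts_monotonically[OF assms(3,4)] by blast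
  then have "acts_monotonically (variety_join V W) (join_alg A B)"
    unfolding acts_monotonically_def by (auto simp: join_alg_member join_alg_compatible)
  then show "\<not> congruence_permutable TYPE(('f + 'g, nat) trm) n (variety_join V W)"
    using \<open>2 \<le> n\<close> by (intro acts_monotonically_not_permutable[OF wf]) auto
qed

end
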